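(* Let $p$ be an odd prime, $x\in\mathbb Z_p$ with $(x-1)x(x+1)(x+2)\not\equiv0\pmod p$, and $x'=(x-\langle x\rangle_p)/p$. Then $$\sum_{n=0}^{p-1}nG_n(x)\equiv\begin{cases}p^2\dfrac{x'(x'+1)(1-x(x+1))-x(x+1)}{(x-1)x(x+1)(x+2)}\pmod{p^3}&\text{if }2\mid\langle x\rangle_p,\\[2mm] p^2\dfrac{x'(x'+1)(1-x(x+1))-(x-1)(x+2)}{(x-1)x(x+1)(x+2)}\pmod{p^3}&\text{if }2\nmid\langle x\rangle_p.\end{cases}$$ Consequently, for every prime $p>3$: $$\sum_{n=0}^{p-1}\frac{nG_n}{16^n}\equiv\begin{cases}-\frac19p^2\pmod{p^3}&\text{if }p\equiv1\pmod4,\\ \frac{31}9p^2\pmod{p^3}&\text{if }p\equiv3\pmod4,\end{cases}\qquad \sum_{n=0}^{p-1}\frac{nG_n^{(3)}}{27^n}\equiv\begin{cases}-\frac1{10}p^2\pmod{p^3}&\text{if }p\equiv1\pmod3,\\ \frac{79}{20}p^2\pmod{p^3}&\text{if }p\equiv2\pmod3,\ p\ne5,\end{cases}$$ $$\sum_{n=0}^{p-1}\frac{nG_n^{(4)}}{64^n}\equiv\begin{cases}-\frac3{35}p^2\pmod{p^3}&\text{if }p\equiv1,3\pmod8,\\ \frac{503}{105}p^2\pmod{p^3}&\text{if }p\equiv5,7\pmod8,\ p\ne5,7,\end{cases}\qquad \sum_{n=0}^{p-1}\frac{nG_n^{(6)}}{432^n}\equiv\begin{cases}-\frac5{77}p^2\pmod{p^3}&\text{if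 }p\equiv1\pmod4,\\ \frac{2567}{385}p^2\pmod{p^3}&\text{if }p\equiv3\pmod4,\ p\ne7,11.\end{cases}$$
   Context: For a real number $x$ and an integer $k\ge0$, $\binom xk=x(x-1)\cdots(x-k+1)/k!$. Define $G_n(x)=\sum_{k=0}^n\binom nk(-1)^k\binom xk\binom{-1-x}k$. For a prime $p$, $\mathbb Z_p$ is the set of rationals whose denominator is not divisible by $p$; congruences modulo powers of $p$ are in $\mathbb Z_p$. For $x\in\mathbb Z_p$, $\langle x\rangle_p\in\{0,\ldots,p-1\}$ satisfies $x\equiv\langle x\rangle_p\pmod p$. Also $G_n=16^nG_n(-\tfrac12)=\sum_{k=0}^n\binom nk(-1)^k\binom{2k}k^216^{n-k}$, $G_n^{(3)}=27^nG_n(-\tfrac13)=\sum_{k=0}^n\binom nk(-1)^k\binom{2k}k\binom{3k}k27^{n-k}$, $G_n^{(4)}=64^nG_n(-\tfrac14)=\sum_{k=0}^n\binom nk(-1)^k\binom{2k}k\binom{4k}{2k}64^{n-k}$, $G_n^{(6)}=432^nG_n(-\tfrac16)=\sum_{k=0}^n\binom nk(-1)^k\binom{3k}k\binom{6k}{3k}432^{n-k}$. *)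

theory Defs
  imports "HOL-Number_Theory.Number_Theory"
begin

definition p_integral :: "nat \<Rightarrow> rat set" where
  "p_integral p = {x. \<not> int p dvd snd (quotient_of x)}"

(* p_cong p m a b is the congruence "a = b mod p^m" in the ring p_integral p;
   both sides are required to lie in that ring. *)
definition p_cong :: "nat \<Rightarrow> nat \<Rightarrow> rat \<Rightarrow> rat \<Rightarrow> bool" where
  "p_cong p m a b \<longleftrightarrow> a \<in> p_integral p \<and> b \<in> p_integral p \<and>
     (\<exists>z \<in> p_integral p. a - b = of_nat p ^ m * z)"

(* Uniquely determined when p is prime and x is p-integral; unspecified otherwise. *)
definition p_residue :: "nat \<Rightarrow> rat \<Rightarrow> nat" where
  "p_residue p x = (THE r. r < p \<and> p_cong p 1 x (of_nat r))"

definition G_poly :: "nat \<Rightarrow> rat \<Rightarrow> rat" where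
  "G_poly n x = (\<Sum>k\<le>n. of_nat (n choose k) * (-1) ^ k * (x gchoose k) * ((-1 - x) gchoose k))"

(* The four integer sequences below are 16^n G_poly n (-1/2), 27^n G_poly n (-1/3),
   64^n G_poly n (-1/4) and 432^n G_poly n (-1/6), respectively. *)
definition G_seq :: "nat \<Rightarrow> int" where
  "G_seq n = (\<Sum>k\<le>n. of_nat (n choose k) * (-1) ^ k *
     of_nat ((2 * k) choose k) ^ 2 * 16 ^ (n - k))"

definition G3_seq :: "nat \<Rightarrow> int" where
  "G3_seq n = (\<Sum>k\<le>n. of_nat (n choose k) * (-1) ^ k *
     of_nat ((2 * k) choose k) * of_nat ((3 * k) choose k) * 27 ^ (n - k))"

definition G4_seq :: "nat \<Rightarrow> int" where
  "G4_seq n = (\<Sum>k\<le>n. of_nat (n choose k) * (-1) ^ k *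
     of_nat ((2 * k) choose k) * of_nat ((4 * k) choose (2 * k)) * 64 ^ (n - k))"

definition G6_seq :: "nat \<Rightarrow> int" where
  "G6_seq n = (\<Sum>k\<le>n. of_nat (n choose k) * (-1) ^ k *
     of_nat ((3 * k) choose k) * of_nat ((6 * k) choose (3 * k)) * 432 ^ (n - k))"

end

theory Submission
  imports Defs "HOL-Computational_Algebra.Formal_Power_Series"
begin

text \<open>
  Put c(k) = (x choose k) (-1-x choose k) and X = x (x+1), so that
  (k+1)^2 c(k+1) = (k (k+1) - X) c(k). Summation by parts against this recurrence turns
  X times a sum of w(k) c(k) into a sum with weights k ((k+1) w(k) - k w(k-1)). Applied twice to the
  weights obtained by exchanging the order of summation, it gives, for every n, the exact identity
  X (X-2) (sum over m < n of m G_m(x))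
    = (n-1) n^2 (sum over 1 <= k <= n of (-1)^k (n-1 choose k-1) (X-1-k) c(k)).
  For n = p the factor p^2 is explicit, and what remains is needed only modulo p, where
  (-1)^(k-1) (p-1 choose k-1) = 1, the sum of c(k) over k < p is (-1)^r with r the residue of x
  (Vandermonde), the sum of k c(k) is X times that, and c(p) = -x'(x'+1).
  The four special cases are x = -1/m, where x'(x'+1) = X.
\<close>

section \<open>The coefficients c(k) and the exact identity over the rationals\<close>

definition c_coeff :: "rat \<Rightarrow> nat \<Rightarrow> rat" where
  "c_coeff x k = (x gchoose k) * ((-1 - x) gchoose k)"

lemma c_coeff_0 [simp]: "c_coeff x 0 = 1"
  by (simp add: c_coeff_def)

text \<open>Each binomial factor obeys (k+1) (y choose k+1) = (y-k) (y choose k), and (x-k) (-1-x-k)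
  = k (k+1) - x (x+1).\<close>

lemma c_coeff_Suc:
  "(of_nat k + 1)^2 * c_coeff x (Suc k) = (of_nat k * (of_nat k + 1) - x * (x + 1)) * c_coeff x k"
proof -
  have step: "(of_nat k + 1) * (y gchoose Suc k) = (y - of_nat k) * (y gchoose k)" for y :: rat
    using gbinomial_absorb_comp[of y k] gbinomial_absorption[of k y]
    by (simp add: algebra_simps)
  have "(of_nat k + 1)^2 * c_coeff x (Suc k)
      = ((of_nat k + 1) * (x gchoose Suc k)) * ((of_nat k + 1) * ((-1 - x) gchoose Suc k))"
    by (simp only: c_coeff_def power2_eq_square mult_ac)
  also have "\<dots> = (of_nat k * (of_nat k + 1) - x * (x + 1)) * c_coeff x k"
    unfolding step by (simp add: c_coeff_def algebra_simps)
  finally show ?thesis .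
qed

text \<open>The recurrence gives X w(k) c(k) = k (k+1) w(k) c(k) - (k+1)^2 w(k) c(k+1); the second
  term is then shifted by one index. At index 0 the truncated \<open>k - 1\<close> is harmless
  because of the factor k (or n^2 in the boundary term).\<close>

lemma sum_by_parts_c_coeff:
  fixes w :: "nat \<Rightarrow> rat"
  shows "x * (x + 1) * (\<Sum>k<n. w k * c_coeff x k)
    = (\<Sum>k<n. of_nat k * ((of_nat k + 1) * w k - of_nat k * w (k - 1)) * c_coeff x k)
      - (of_nat n)^2 * w (n - 1) * c_coeff x n"
proof (induction n)
  case 0
  then show ?case by simp
next
  case (Suc n)
  have rec: "(of_nat (Suc n))^2 * w n * c_coeff x (Suc n)
      = w n * ((of_nat n * (of_nat n + 1) - x * (x + 1)) * c_coeff x n)"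
    using c_coeff_Suc[of n x] by (simp add: mult_ac add_ac)
  show ?case
    using Suc.IH rec by (simp add: algebra_simps power2_eq_square)
qed

lemma choose_step: "(of_nat k + 1) * of_nat (n choose Suc k) = (of_nat n - of_nat k) * (of_nat (n choose k) :: rat)"
  using gbinomial_absorb_comp[of "of_nat n :: rat" k] gbinomial_absorption[of k "of_nat n :: rat"]
  by (simp add: algebra_simps flip: binomial_gbinomial)

lemma choose_absorb: "of_nat k * of_nat (Suc n choose k) = of_nat (Suc n) * (if k = 0 then 0 else of_nat (n choose (k - 1)) :: rat)"
proof (cases k)
  case (Suc j)
  have "of_nat (Suc j * (Suc n choose Suc j)) = (of_nat (Suc n * (n choose j)) :: rat)"
    by (subst binomial_absorption) simp
  then show ?thesis
    by (simp only: Suc of_nat_mult) simp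
qed simp

text \<open>A weighted hockey-stick identity: by Pascal's rule, passing from n to n+1 raises the
  right side by n (n choose k).\<close>

lemma sum_index_mult_choose:
  "(\<Sum>m<n. of_nat m * of_nat (m choose k)) = (of_nat n - 1) * of_nat (n choose Suc k) - (of_nat (n choose Suc (Suc k)) :: rat)"
  by (induction n) (simp_all add: algebra_simps)

lemma sum_index_mult_G_poly:
  "(\<Sum>m<n. of_nat m * G_poly m x)
    = (\<Sum>k<n. (-1)^k * ((of_nat n - 1) * of_nat (n choose Suc k) - of_nat (n choose Suc (Suc k))) * c_coeff x k)"
proof -
  \<comment> \<open>Since (m choose k) = 0 for k > m, all inner sums can run over the common range k
    < n, which makes them interchangeable.\<close>
  have "G_poly m x = (\<Sum>k<n. of_nat (m choose k) * (-1)^k * c_coeff x k)" if "m < n" for m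
    unfolding G_poly_def c_coeff_def using that
    by (intro sum.mono_neutral_cong_left) (auto simp: mult_ac)
  then have "(\<Sum>m<n. of_nat m * G_poly m x)
      = (\<Sum>m<n. \<Sum>k<n. of_nat m * of_nat (m choose k) * ((-1)^k * c_coeff x k))"
    by (simp add: sum_distrib_left mult_ac)
  also have "\<dots> = (\<Sum>k<n. (\<Sum>m<n. of_nat m * of_nat (m choose k)) * ((-1)^k * c_coeff x k))"
    by (subst sum.swap) (simp add: sum_distrib_right)
  finally show ?thesis
    by (simp add: sum_index_mult_choose mult_ac)
qed

text \<open>Stated for \<open>Suc n\<close> to avoid truncated subtraction. With N = n+1 the sum is
  (N-1) \<open>A\<close> - \<open>B\<close>. Summation by parts sends \<open>A\<close> and
  \<open>E\<close> to the target sums \<open>U\<close> and \<open>V\<close>, while \<open>B\<close>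
  reproduces 2 \<open>B\<close> plus terms in \<open>A\<close> and \<open>E\<close>; moving 2
  \<open>B\<close> to the left is the source of the factor X - 2.\<close>

lemma sum_index_mult_G_poly_closed:
  "x * (x + 1) * (x * (x + 1) - 2) * (\<Sum>m<Suc n. of_nat m * G_poly m x)
    = of_nat n * (of_nat (Suc n))^2 *
      (\<Sum>k\<le>n. (-1)^Suc k * of_nat (n choose k) * (x * (x + 1) - 1 - of_nat (Suc k)) * c_coeff x (Suc k))"
proof -
  define X where "X = x * (x + 1)"
  define N :: rat where "N = of_nat (Suc n)"
  define C :: "nat \<Rightarrow> rat" where "C k = of_nat (Suc n choose k)" for k
  define C' :: "nat \<Rightarrow> rat" where "C' k = of_nat (n choose k)" for k
  define c where "c = c_coeff x"
  define A where "A = (\<Sum>k<Suc n. (-1)^k * C (Suc k) * c k)"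
  define B where "B = (\<Sum>k<Suc n. (-1)^k * C (Suc (Suc k)) * c k)"
  define E where "E = (\<Sum>k<Suc n. (-1)^k * ((N - 1) * C' k - C' (Suc k)) * c k)"
  define U where "U = (\<Sum>k\<le>n. (-1)^Suc k * C' k * c (Suc k))"
  define V where "V = (\<Sum>k\<le>n. (-1)^Suc k * C' k * of_nat (Suc k) * c (Suc k))"
  have Nn: "of_nat n = N - 1" by (simp add: N_def)
  have parts: "X * (\<Sum>k<Suc n. w k * c k)
    = (\<Sum>k<Suc n. of_nat k * ((of_nat k + 1) * w k - of_nat k * w (k - 1)) * c k)
      - N^2 * w n * c (Suc n)" for w
    using sum_by_parts_c_coeff[of x w "Suc n"] by (simp add: X_def c_def N_def)
  have step: "(of_nat k + 1) * C (Suc k) = (N - of_nat k) * C k" for k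
    unfolding C_def N_def by (rule choose_step)
  have step': "(of_nat k + 1) * C' (Suc k) = (N - 1 - of_nat k) * C' k" for k
    unfolding C'_def Nn[symmetric] by (rule choose_step)
  have pascal: "C (Suc k) = C' k + C' (Suc k)" for k
    by (simp add: C_def C'_def)
  have absorb: "(of_nat k + 1) * C (Suc k) = N * C' k" for k
    using choose_absorb[of "Suc k" n] by (simp add: C_def C'_def N_def add_ac)
  have top: "C (Suc n) = 1" "C (Suc (Suc n)) = 0" "C' n = 1" "C' (Suc n) = 0"
    by (simp_all add: C_def C'_def binomial_eq_0)
  \<comment> \<open>The weights collapse by (k+1) C(k+1) + k C(k) = N C(k) and k C(k) = N C'(k-1).
    The boundary term supplies the last summand, k = n, of \<open>U\<close>.\<close>
  have XA: "X * A = N^2 * U"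
  proof -
    have "of_nat k * ((of_nat k + 1) * ((-1)^k * C (Suc k)) - of_nat k * ((-1)^(k-1) * C (Suc (k - 1))))
        = N^2 * (if k = 0 then 0 else (-1)^k * C' (k - 1))" for k
    proof (cases k)
      case (Suc j)
      have "(of_nat k + 1) * C (Suc k) + of_nat k * C k = N * C k"
        using step[of k] by (simp add: algebra_simps)
      moreover have "of_nat k * C k = N * C' j"
        using absorb[of j] by (simp add: Suc add_ac)
      ultimately have "of_nat k * ((of_nat k + 1) * C (Suc k) + of_nat k * C k) = N^2 * C' j"
        by (simp add: power2_eq_square mult_ac)
      then have "(-1)^k * (of_nat k * ((of_nat k + 1) * C (Suc k) + of_nat k * C k)) = (-1)^k * (N^2 * C' j)"
        by simp
      then show ?thesis
        by (simp add: Suc algebra_simps)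
    qed simp
    then have "X * A = (\<Sum>k<Suc n. N^2 * (if k = 0 then 0 else (-1)^k * C' (k - 1)) * c k) - N^2 * (-1)^n * c (Suc n)"
      unfolding A_def parts by (simp add: top)
    also have "\<dots> = N^2 * U"
      unfolding U_def sum.lessThan_Suc_shift
      by (simp add: sum_distrib_left lessThan_Suc_atMost[symmetric] top algebra_simps)
    finally show ?thesis .
  qed
  \<comment> \<open>Here the boundary term vanishes, since (N choose N+1) = 0.\<close>
  have XB: "X * B = 2 * B - (N - 1) * A + N * E"
  proof -
    have "of_nat k * ((of_nat k + 1) * ((-1)^k * C (Suc (Suc k))) - of_nat k * ((-1)^(k-1) * C (Suc (Suc (k - 1)))))
        = (-1)^k * (2 * C (Suc (Suc k)) - (N - 1) * C (Suc k) + N * ((N - 1) * C' k - C' (Suc k)))" for k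
    proof -
      have "(of_nat k + 2) * C (Suc (Suc k)) = (N - of_nat k - 1) * C (Suc k)"
        using step[of "Suc k"] by (simp add: algebra_simps)
      then have 1: "(of_nat k + 1) * C (Suc (Suc k)) + of_nat k * C (Suc k) = (N - 1) * C (Suc k) - C (Suc (Suc k))"
        by (simp add: algebra_simps)
      have 2: "(of_nat k + 1) * C (Suc k) = N * C' k" "(of_nat k + 2) * C (Suc (Suc k)) = N * C' (Suc k)"
        using absorb[of k] absorb[of "Suc k"] by (simp_all add: algebra_simps)
      have "of_nat k * ((of_nat k + 1) * C (Suc (Suc k)) + of_nat k * C (Suc k))
          = (N - 1) * (of_nat k * C (Suc k)) - of_nat k * C (Suc (Suc k))"
        unfolding 1 by (simp add: algebra_simps)
      also have "\<dots> = (N - 1) * (N * C' k - C (Suc k)) - (N * C' (Suc k) - 2 * C (Suc (Suc k)))"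
      proof -
        have "of_nat k * C (Suc k) = N * C' k - C (Suc k)"
          "of_nat k * C (Suc (Suc k)) = N * C' (Suc k) - 2 * C (Suc (Suc k))"
          using 2 by (simp_all add: algebra_simps)
        then show ?thesis by (simp only:)
      qed
      finally have "of_nat k * ((of_nat k + 1) * C (Suc (Suc k)) + of_nat k * C (Suc k))
         = 2 * C (Suc (Suc k)) - (N - 1) * C (Suc k) + N * ((N - 1) * C' k - C' (Suc k))"
        by (simp add: algebra_simps)
      \<comment> \<open>The case split turns (-1)^(k-1) into -(-1)^k; for k = 0 the factor k removes
        that term.\<close>
      from arg_cong[OF this, of "\<lambda>t. (-1)^k * t"] show ?thesis
        by (cases k) (simp_all add: algebra_simps)
    qed
    then have "X * B = (\<Sum>k<Suc n. (-1)^k * (2 * C (Suc (Suc k)) - (N - 1) * C (Suc k) + N * ((N - 1) * C' k - C' (Suc k))) * c k)"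
      unfolding B_def parts by (simp add: top)
    also have "\<dots> = 2 * B - (N - 1) * A + N * E"
      unfolding A_def B_def E_def sum_distrib_left sum_subtractf[symmetric] sum.distrib[symmetric]
      by (rule sum.cong) (simp_all add: algebra_simps)
    finally show ?thesis .
  qed
  \<comment> \<open>As for \<open>A\<close>, the boundary term is the summand k = n of
    \<open>V\<close>; its extra factor \<open>Suc n\<close> = N accounts for N^2 (N-1).\<close>
  have XE: "X * E = N * (N - 1) * V"
  proof -
    have "of_nat k * ((of_nat k + 1) * ((-1)^k * ((N - 1) * C' k - C' (Suc k)))
          - of_nat k * ((-1)^(k-1) * ((N - 1) * C' (k - 1) - C' (Suc (k - 1)))))
        = N * (N - 1) * (if k = 0 then 0 else (-1)^k * of_nat k * C' (k - 1))" for k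
    proof (cases k)
      case (Suc j)
      have 1: "(of_nat k + 1) * C' (Suc k) = (N - 1 - of_nat k) * C' k" by (rule step')
      have 2: "of_nat k * C k = N * C' j"
        using absorb[of j] by (simp add: Suc add_ac)
      have 3: "C k = C' j + C' k" by (simp add: Suc pascal)
      have "(of_nat k + 1) * ((N - 1) * C' k - C' (Suc k)) + of_nat k * ((N - 1) * C' j - C' k)
          = (of_nat k + 1) * (N - 1) * C' k - (of_nat k + 1) * C' (Suc k) + of_nat k * ((N - 1) * C' j - C' k)"
        by (simp add: algebra_simps)
      also have "\<dots> = (N - 1) * (of_nat k * C k)"
        unfolding 1 3 by (simp add: algebra_simps)
      finally have "(of_nat k + 1) * ((N - 1) * C' k - C' (Suc k)) + of_nat k * ((N - 1) * C' j - C' k)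
          = (N - 1) * (N * C' j)" by (simp only: 2)
      from arg_cong[OF this, of "\<lambda>t. (-1)^k * of_nat k * t"] show ?thesis
        by (simp add: Suc algebra_simps)
    qed simp
    then have "X * E = (\<Sum>k<Suc n. N * (N - 1) * (if k = 0 then 0 else (-1)^k * of_nat k * C' (k - 1)) * c k)
        - N^2 * (-1)^n * (N - 1) * c (Suc n)"
      unfolding E_def parts by (simp add: top)
    also have "\<dots> = N * (N - 1) * V"
      unfolding V_def sum.lessThan_Suc_shift
      by (simp add: sum_distrib_left lessThan_Suc_atMost[symmetric] top Nn algebra_simps power2_eq_square)
    finally show ?thesis .
  qed
  have S: "(\<Sum>m<Suc n. of_nat m * G_poly m x) = (N - 1) * A - B"
    unfolding sum_index_mult_G_poly A_def B_def sum_distrib_left sum_subtractf[symmetric]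
    by (rule sum.cong) (simp_all add: C_def c_def N_def algebra_simps)
  have W: "(\<Sum>k\<le>n. (-1)^Suc k * C' k * (X - 1 - of_nat (Suc k)) * c (Suc k)) = (X - 1) * U - V"
    unfolding U_def V_def sum_distrib_left sum_subtractf[symmetric]
    by (rule sum.cong) (simp_all add: algebra_simps)
  have "X * (X - 2) * ((N - 1) * A - B) = (N - 1) * (X - 2) * (X * A) - X * (X * B - 2 * B)"
    by (simp add: algebra_simps)
  also have "X * B - 2 * B = N * E - (N - 1) * A"
    using XB by simp
  \<comment> \<open>The two multiples X - 2 and 1 of X \<open>A\<close> merge into X - 1, so
    \<open>B\<close> has disappeared.\<close>
  also have "(N - 1) * (X - 2) * (X * A) - X * (N * E - (N - 1) * A)
      = (N - 1) * (X - 1) * (X * A) - N * (X * E)"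
    by (simp add: algebra_simps)
  also have "\<dots> = (N - 1) * N^2 * ((X - 1) * U - V)"
    unfolding XA XE by (simp add: algebra_simps power2_eq_square)
  finally show ?thesis
    unfolding S[symmetric] W[symmetric] by (simp add: X_def N_def C'_def c_def)
qed

lemma gbinomial_neg_one: "((-1) gchoose k) = ((-1) ^ k :: 'a::field_char_0)"
  using gbinomial_minus[of "1 :: 'a" k] by (simp flip: binomial_gbinomial)

section \<open>Arithmetic and congruences in the ring of p-integral rationals\<close>

text \<open>The reduced denominator divides every other denominator, so any representation with
  denominator prime to p will do. This makes the closure properties a matter of multiplying
  denominators.\<close>

lemma p_integral_iff:
  assumes "prime p"
  shows "x \<in> p_integral p \<longleftrightarrow> (\<exists>a b. \<not> int p dvd b \<and> x = of_int a / of_int b)"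
proof
  assume "x \<in> p_integral p"
  moreover obtain a b where "quotient_of x = (a, b)" by force
  ultimately show "\<exists>a b. \<not> int p dvd b \<and> x = of_int a / of_int b"
    using quotient_of_div[of x a b] by (auto simp: p_integral_def)
next
  assume "\<exists>a b. \<not> int p dvd b \<and> x = of_int a / of_int b"
  then obtain a b where ab: "\<not> int p dvd b" "x = of_int a / of_int b" by blast
  obtain c d where q: "quotient_of x = (c, d)" by force
  have "d > 0" "x = of_int c / of_int d" "coprime c d"
    using quotient_of_denom_pos[OF q] quotient_of_div[OF q] quotient_of_coprime[OF q] by auto
  moreover have "b \<noteq> 0" using ab by auto
  ultimately have "(of_int (a * d) :: rat) = of_int (c * b)"
    using ab by (simp add: field_simps)
  then have "a * d = c * b" by (simp only: of_int_eq_iff)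
  then have "d dvd c * b" by (metis dvd_triv_right)
  then have "d dvd b"
    using \<open>coprime c d\<close> by (simp add: coprime_commute coprime_dvd_mult_right_iff)
  then show "x \<in> p_integral p"
    using ab q by (auto simp: p_integral_def dest: dvd_trans)
qed

context
  fixes p :: nat
  assumes p: "prime p"
begin

lemma p_integral_of_int [simp]: "of_int a \<in> p_integral p"
proof -
  have "\<not> int p dvd 1" using p by auto
  then show ?thesis by (subst p_integral_iff[OF p]) (rule exI[of _ a], rule exI[of _ 1], simp)
qed

lemma p_integral_of_nat [simp]: "of_nat a \<in> p_integral p"
  using p_integral_of_int[of "int a"] by simp

lemma p_integral_numeral [simp]: "0 \<in> p_integral p" "1 \<in> p_integral p" "numeral n \<in> p_integral p"
  using p_integral_of_int[of 0] p_integral_of_int[of 1] p_integral_of_int[of "numeral n"] by simp_all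

lemma p_integral_add [intro, simp]:
  assumes "x \<in> p_integral p" "y \<in> p_integral p"
  shows "x + y \<in> p_integral p"
proof -
  from assms obtain a b c d where *: "\<not> int p dvd b" "x = of_int a / of_int b" "\<not> int p dvd d" "y = of_int c / of_int d"
    unfolding p_integral_iff[OF p] by blast
  then have "b \<noteq> 0" "d \<noteq> 0" by auto
  then have "x + y = of_int (a * d + c * b) / of_int (b * d)"
    using * by (simp add: field_simps)
  moreover have "\<not> int p dvd b * d" using * p by (simp add: prime_dvd_mult_iff)
  ultimately show ?thesis unfolding p_integral_iff[OF p] by blast
qed

lemma p_integral_mult [intro, simp]:
  assumes "x \<in> p_integral p" "y \<in> p_integral p"
  shows "x * y \<in> p_integral p"
proof -
  from assms obtain a b c d where *: "\<not> int p dvd b" "x = of_int a / of_int b" "\<not> int p dvd d" "y = of_int c / of_int d"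
    unfolding p_integral_iff[OF p] by blast
  then have "x * y = of_int (a * c) / of_int (b * d)" by simp
  moreover have "\<not> int p dvd b * d" using * p by (simp add: prime_dvd_mult_iff)
  ultimately show ?thesis unfolding p_integral_iff[OF p] by blast
qed

lemma p_integral_minus [intro, simp]: "x \<in> p_integral p \<Longrightarrow> - x \<in> p_integral p"
  using p_integral_mult[OF p_integral_of_int[of "-1"], of x] by simp

lemma p_integral_diff [intro, simp]: "x \<in> p_integral p \<Longrightarrow> y \<in> p_integral p \<Longrightarrow> x - y \<in> p_integral p"
  using p_integral_add[of x "- y"] by simp

lemma p_integral_power [intro, simp]: "x \<in> p_integral p \<Longrightarrow> x ^ n \<in> p_integral p"
  by (induction n) auto

lemma p_integral_prod [intro, simp]: "(\<And>i. i \<in> I \<Longrightarrow> f i \<in> p_integral p) \<Longrightarrow> prod f I \<in> p_integral p"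
  by (induction I rule: infinite_finite_induct) auto

lemma p_integral_div_of_int:
  assumes "x \<in> p_integral p" "\<not> int p dvd b"
  shows "x / of_int b \<in> p_integral p"
proof -
  have "of_int 1 / of_int b \<in> p_integral p" using assms(2) p_integral_iff[OF p] by blast
  then show ?thesis using p_integral_mult[OF assms(1), of "1 / of_int b"] by simp
qed

lemma p_integral_div_fact:
  assumes "x \<in> p_integral p" "k < p"
  shows "x / fact k \<in> p_integral p"
proof -
  have "\<not> p dvd fact k" using assms(2) p by (simp add: prime_dvd_fact_iff)
  then have "\<not> int p dvd fact k" by (metis int_dvd_int_iff of_nat_fact)
  from p_integral_div_of_int[OF assms(1) this] show ?thesis by simp
qed

lemma p_congI: "a \<in> p_integral p \<Longrightarrow> b \<in> p_integral p \<Longrightarrow> z \<in> p_integral p \<Longrightarrow> a - b = of_nat p ^ m * z \<Longrightarrow> p_cong p m a b"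
  by (auto simp: p_cong_def)

lemma p_cong_refl: "a \<in> p_integral p \<Longrightarrow> p_cong p m a a"
  by (rule p_congI[of _ _ 0]) auto

lemma p_cong_sym: "p_cong p m a b \<Longrightarrow> p_cong p m b a"
  unfolding p_cong_def by (metis minus_diff_eq mult_minus_right p_integral_minus)

lemma p_cong_add: "p_cong p m a b \<Longrightarrow> p_cong p m c d \<Longrightarrow> p_cong p m (a + c) (b + d)"
  unfolding p_cong_def
proof (elim conjE bexE, intro conjI)
  fix y z
  assume *: "y \<in> p_integral p" "z \<in> p_integral p" "a - b = of_nat p ^ m * y" "c - d = of_nat p ^ m * z"
  have "(a + c) - (b + d) = (a - b) + (c - d)" by simp
  also have "\<dots> = of_nat p ^ m * (y + z)" by (simp only: * distrib_left)
  finally show "\<exists>z\<in>p_integral p. (a + c) - (b + d) = of_nat p ^ m * z" using * by blast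
qed auto

lemma p_cong_mult: "p_cong p m a b \<Longrightarrow> p_cong p m c d \<Longrightarrow> p_cong p m (a * c) (b * d)"
  unfolding p_cong_def
proof (elim conjE bexE, intro conjI)
  fix y z
  assume *: "y \<in> p_integral p" "z \<in> p_integral p" "a - b = of_nat p ^ m * y" "c - d = of_nat p ^ m * z"
    "b \<in> p_integral p" "c \<in> p_integral p"
  have "(a * c) - (b * d) = (a - b) * c + b * (c - d)" by (simp add: algebra_simps)
  also have "\<dots> = of_nat p ^ m * (y * c + b * z)" by (simp add: * algebra_simps)
  finally show "\<exists>z\<in>p_integral p. (a * c) - (b * d) = of_nat p ^ m * z" using * by blast
qed auto

lemma p_cong_trans:
  assumes "p_cong p m a b" "p_cong p m b c"
  shows "p_cong p m a c"
proof -
  have "b \<in> p_integral p" using assms by (simp add: p_cong_def)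
  have "p_cong p m (a + b + - b) (b + c + - b)"
    using assms \<open>b \<in> _\<close> by (intro p_cong_add p_cong_refl) auto
  then show ?thesis by simp
qed

lemma p_cong_cmult: "c \<in> p_integral p \<Longrightarrow> p_cong p m a b \<Longrightarrow> p_cong p m (c * a) (c * b)"
  by (intro p_cong_mult p_cong_refl)

lemma p_cong_diff: "p_cong p m a b \<Longrightarrow> p_cong p m c d \<Longrightarrow> p_cong p m (a - c) (b - d)"
  using p_cong_add[of m a b "-1 * c" "-1 * d"] p_cong_cmult[of "-1" m c d] by simp

lemma p_cong_sum: "(\<And>i. i \<in> I \<Longrightarrow> p_cong p m (f i) (g i)) \<Longrightarrow> p_cong p m (sum f I) (sum g I)"
  by (induction I rule: infinite_finite_induct) (auto intro: p_cong_add p_cong_refl)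

lemma p_cong_prod: "(\<And>i. i \<in> I \<Longrightarrow> p_cong p m (f i) (g i)) \<Longrightarrow> p_cong p m (prod f I) (prod g I)"
  by (induction I rule: infinite_finite_induct) (auto intro: p_cong_mult p_cong_refl)

lemma p_cong_div_fact: "p_cong p m a b \<Longrightarrow> k < p \<Longrightarrow> p_cong p m (a / fact k) (b / fact k)"
  using p_cong_cmult[of "1 / fact k" m a b] p_integral_div_fact[of 1 k] by simp

text \<open>Once p^2 has been split off, a congruence modulo p suffices for one modulo p^3.\<close>

lemma p_cong_power_mult: "p_cong p m a b \<Longrightarrow> p_cong p (n + m) (of_nat p ^ n * a) (of_nat p ^ n * b)"
  unfolding p_cong_def by (auto simp: power_add right_diff_distrib[symmetric])

lemma p_cong_of_int_iff: "p_cong p 1 (of_int a) (of_int b) \<longleftrightarrow> [a = b] (mod int p)"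
proof
  assume "p_cong p 1 (of_int a) (of_int b)"
  then obtain z where "z \<in> p_integral p" "of_int a - of_int b = of_nat p * z"
    by (auto simp: p_cong_def)
  then obtain c d where cd: "\<not> int p dvd d" "of_int a - of_int b = of_nat p * (of_int c / of_int d :: rat)"
    unfolding p_integral_iff[OF p] by blast
  then have "d \<noteq> 0" by auto
  then have "of_int ((a - b) * d) = (of_int (int p * c) :: rat)"
    using cd by (simp add: field_simps)
  then have "(a - b) * d = int p * c" by (simp only: of_int_eq_iff)
  then have "int p dvd (a - b) * d" by simp
  then show "[a = b] (mod int p)"
    using cd p by (simp add: prime_dvd_mult_iff cong_iff_dvd_diff)
next
  assume "[a = b] (mod int p)"
  then obtain k where k: "a - b = int p * k" by (auto simp: cong_iff_dvd_diff)
  have "(of_int a :: rat) - of_int b = of_int (a - b)" by simp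
  also have "\<dots> = of_nat p ^ 1 * of_int k" unfolding k by simp
  finally show "p_cong p 1 (of_int a) (of_int b)"
    by (intro p_congI[of _ _ "of_int k"]) auto
qed

text \<open>If x = a/b with p dividing neither b nor a, then b/a is p-integral; p dividing a would
  force x to be 0 modulo p.\<close>

lemma inverse_p_integral:
  assumes "x \<in> p_integral p" "\<not> p_cong p 1 x 0"
  shows "1 / x \<in> p_integral p"
proof -
  obtain a b where ab: "\<not> int p dvd b" "x = of_int a / of_int b"
    using assms(1) unfolding p_integral_iff[OF p] by blast
  have "\<not> int p dvd a"
  proof
    assume "int p dvd a"
    then have "p_cong p 1 (of_int a) (of_int 0)"
      by (simp only: p_cong_of_int_iff cong_0_iff)
    then have "p_cong p 1 (1 / of_int b * of_int a) (1 / of_int b * of_int 0)"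
      using ab by (intro p_cong_cmult p_integral_div_of_int) auto
    then show False using ab assms by simp
  qed
  then show ?thesis
    using ab p_integral_div_of_int[of "of_int b" a] by simp
qed

lemma p_residue_eqI:
  assumes "r < p" "p_cong p 1 x (of_nat r)"
  shows "p_residue p x = r"
  unfolding p_residue_def
proof (rule the_equality)
  fix s assume s: "s < p \<and> p_cong p 1 x (of_nat s)"
  then have "p_cong p 1 (of_int (int s)) (of_int (int r))"
    using assms by (metis of_int_of_nat_eq p_cong_sym p_cong_trans)
  then have "[int s = int r] (mod int p)" by (simp only: p_cong_of_int_iff)
  then show "s = r" using s assms(1) by (simp add: cong_def)
qed (use assms in auto)

lemma p_residue:
  assumes "x \<in> p_integral p"
  shows "p_residue p x < p" and "p_cong p 1 x (of_nat (p_residue p x))"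
proof -
  obtain a b where ab: "\<not> int p dvd b" "x = of_int a / of_int b"
    using assms(1) unfolding p_integral_iff[OF p] by blast
  have "coprime b (int p)"
    using ab(1) p prime_imp_coprime[of "int p" b] by (simp add: coprime_commute)
  \<comment> \<open>\<open>c\<close> inverts the denominator modulo p, so the residue of a/b is a c
    mod p.\<close>
  then obtain c where c: "[b * c = 1] (mod int p)" by (metis cong_solve_coprime_int)
  define r where "r = nat ((a * c) mod int p)"
  have pos: "int p > 0" using p by (simp add: prime_gt_0_nat)
  have r: "r < p" "int r = (a * c) mod int p"
    using pos by (simp_all add: r_def nat_less_iff)
  have "[a * 1 = a * (b * c)] (mod int p)"
    using c by (intro cong_mult) (auto simp: cong_sym_eq)
  moreover have "[a * c * b = int r * b] (mod int p)"
    unfolding r(2) by (intro cong_mult) (auto simp: cong_def)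
  ultimately have "[a = int r * b] (mod int p)"
    by (simp add: mult_ac cong_def)
  then have "p_cong p 1 (of_int a) (of_int (int r * b))" by (simp only: p_cong_of_int_iff)
  then have "p_cong p 1 (1 / of_int b * of_int a) (1 / of_int b * of_int (int r * b))"
    using ab by (intro p_cong_cmult p_integral_div_of_int) auto
  moreover have "b \<noteq> 0" using ab by auto
  ultimately have *: "p_cong p 1 x (of_nat r)" using ab by simp
  show "p_residue p x < p" "p_cong p 1 x (of_nat (p_residue p x))"
    using r * p_residue_eqI[OF r(1) *] by auto
qed

section \<open>Binomial coefficients modulo p\<close>

text \<open>In the product formula the only denominator is k!, a unit modulo p exactly because k <
  p. The index k = p therefore needs a separate argument.\<close>

lemma p_cong_gbinomial:
  assumes "p_cong p m x y" "k < p"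
  shows "p_cong p m (x gchoose k) (y gchoose k)"
  unfolding gbinomial_prod_rev
  using assms by (intro p_cong_div_fact p_cong_prod p_cong_diff p_cong_refl) auto

text \<open>p - 1 is -1 modulo p, and (-1 choose k) = (-1)^k.\<close>

lemma p_cong_choose_pred:
  assumes "k < p"
  shows "p_cong p 1 (of_nat ((p - 1) choose k)) ((-1) ^ k)"
proof -
  have "of_nat (p - 1) = (of_nat p - 1 :: rat)"
    using prime_gt_0_nat[OF p] by (simp add: of_nat_diff)
  then have "p_cong p 1 (of_nat (p - 1)) (-1)"
    by (intro p_congI[of _ _ 1]) auto
  from p_cong_gbinomial[OF this assms] show ?thesis
    by (simp only: binomial_gbinomial gbinomial_neg_one)
qed

text \<open>Among the factors x - i with i < p, the one for i = r equals p x' and cancels the p in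
  p!. The product of the others is (p-1)! modulo p.\<close>

lemma p_cong_gbinomial_prime:
  assumes "odd p" "r < p" "x' \<in> p_integral p"
  shows "p_cong p 1 ((of_nat r + of_nat p * x') gchoose p) x'"
proof -
  define x where "x = of_nat r + of_nat p * x'"
  have p0: "(of_nat p :: rat) \<noteq> 0" using p by auto
  define n where "n = p - 1"
  have n: "p = Suc n" "even n" using prime_gt_0_nat[OF p] assms(1) by (auto simp: n_def)
  have x: "p_cong p 1 x (of_nat r)"
    by (rule p_congI[of _ _ x']) (use assms in \<open>auto simp: x_def\<close>)
  define P where "P y = (\<Prod>i\<in>{..<p} - {r}. y - of_nat i)" for y :: rat
  have "(\<Prod>i<p. x - of_nat i) = (x - of_nat r) * P x"
    unfolding P_def by (rule prod.remove) (use assms(2) in auto)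
  then have "x gchoose p = (of_nat p * x') * P x / (of_nat p * fact n)"
    unfolding gbinomial_prod_rev using n by (simp add: x_def lessThan_atLeast0)
  then have C: "x gchoose p = x' * P x / fact n" using p0 by simp
  have "{..<p} - {r} = {..<r} \<union> {r<..<p}" using assms(2) by auto
  then have "P (of_nat r) = (\<Prod>i<r. of_nat r - of_nat i) * (\<Prod>i\<in>{r<..<p}. of_nat r - of_nat i)"
    unfolding P_def by (simp add: prod.union_disjoint disjoint_iff)
  also have "(\<Prod>i<r. of_nat r - of_nat i) = (fact r :: rat)"
    using gbinomial_prod_rev[of "of_nat r :: rat" r]
    by (simp add: lessThan_atLeast0 binomial_gbinomial[symmetric])
  also have "(\<Prod>i\<in>{r<..<p}. of_nat r - of_nat i) = (\<Prod>i<n-r. - (1 + of_nat i) :: rat)"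
    using assms(2) n
    \<comment> \<open>The indices above r are written as r + 1 + i with i < n - r, so each factor
      becomes -(1 + i).\<close>
    by (intro prod.reindex_bij_witness[of _ "\<lambda>i. r + 1 + i" "\<lambda>i. i - r - 1"]) auto
  also have "\<dots> = (-1) ^ (n - r) * fact (n - r)"
    unfolding prod_uminus by (simp add: fact_prod_Suc lessThan_atLeast0)
  finally have Pr: "P (of_nat r) = (-1) ^ (n - r) * (fact r * fact (n - r))" by simp
  have rn: "r \<le> n" using assms(2) n by simp
  have "even (n - r) \<longleftrightarrow> even r" using n rn by auto
  then have "(-1)^(n-r) = ((-1)^r :: rat)" by (simp add: minus_one_power_iff)
  moreover have "(of_nat (n choose r) :: rat) * (fact r * fact (n - r)) = fact n"
    by (simp add: binomial_fact[OF rn])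
  \<comment> \<open>The multiplier (-1)^r (n choose r) turns the product into n! exactly (the sign
    is right because n = p - 1 is even), and it is itself 1 modulo p. This compares the product with
    (p-1)! without evaluating either.\<close>
  ultimately have "(-1)^r * of_nat (n choose r) * P (of_nat r) = fact n"
    unfolding Pr by (simp add: mult_ac)
  moreover have "p_cong p 1 ((-1)^r * of_nat (n choose r) * P (of_nat r)) ((-1)^r * (-1)^r * P (of_nat r))"
    using p_cong_choose_pred[OF assms(2)] n_def
    by (intro p_cong_mult p_cong_refl) (auto simp: P_def)
  ultimately have "p_cong p 1 (fact n) (P (of_nat r))" by simp
  moreover have "p_cong p 1 (P x) (P (of_nat r))"
    unfolding P_def by (intro p_cong_prod p_cong_diff x p_cong_refl) auto
  ultimately have "p_cong p 1 (P x) (fact n)" by (metis p_cong_sym p_cong_trans)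
  then have "p_cong p 1 (x' * (P x / fact n)) (x' * (fact n / fact n))"
    using n by (intro p_cong_cmult p_cong_div_fact assms) auto
  then show ?thesis using C x_def by simp
qed

end

section \<open>Sums of c(k) modulo p and the general congruence\<close>

text \<open>Terms beyond r vanish; after (r choose k) = (r choose r-k), Vandermonde gives (-1 choose
  r).\<close>

lemma sum_c_coeff_of_nat:
  assumes "r < n"
  shows "(\<Sum>k<n. c_coeff (of_nat r) k) = (-1) ^ r"
proof -
  have "(\<Sum>k<n. c_coeff (of_nat r) k) = (\<Sum>k=0..r. c_coeff (of_nat r) k)"
    using assms
    by (intro sum.mono_neutral_right) (auto simp: c_coeff_def binomial_eq_0 simp flip: binomial_gbinomial)
  also have "\<dots> = (\<Sum>k=0..r. ((-1 - of_nat r) gchoose k) * (of_nat r gchoose (r - k)))"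
  proof (rule sum.cong)
    fix k assume "k \<in> {0..r}"
    then have "(of_nat r gchoose k) = (of_nat r gchoose (r - k) :: rat)"
      using binomial_symmetric[of k r] by (simp flip: binomial_gbinomial)
    then show "c_coeff (of_nat r) k = ((-1 - of_nat r) gchoose k) * (of_nat r gchoose (r - k))"
      by (simp only: c_coeff_def mult.commute)
  qed simp
  also have "\<dots> = (-1 - of_nat r + of_nat r) gchoose r"
    by (rule gbinomial_Vandermonde)
  also have "\<dots> = (-1) ^ r"
    by (simp add: gbinomial_neg_one)
  finally show ?thesis .
qed

text \<open>Summation by parts with constant weight 1, where k ((k+1) - k) = k.\<close>

lemma sum_index_mult_c_coeff:
  "(\<Sum>k<n. of_nat k * c_coeff x k) = x * (x + 1) * (\<Sum>k<n. c_coeff x k) + (of_nat n)^2 * c_coeff x n"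
  using sum_by_parts_c_coeff[of x "\<lambda>_. 1" n] by simp

context
  fixes p :: nat
  assumes p: "prime p"
begin

lemma p_cong_sum_c_coeff:
  assumes "r < p" "p_cong p 1 x (of_nat r)"
  shows "p_cong p 1 (\<Sum>k<p. c_coeff x k) ((-1) ^ r)"
  unfolding sum_c_coeff_of_nat[OF assms(1), symmetric] c_coeff_def
  by (intro p_cong_sum p_cong_mult p_cong_gbinomial p_cong_diff p_cong_refl assms p) (auto simp: p)

lemma p_cong_c_coeff_prime:
  assumes "odd p" "r < p" "x' \<in> p_integral p"
  shows "p_cong p 1 (c_coeff (of_nat r + of_nat p * x') p) (- x' * (x' + 1))"
proof -
  \<comment> \<open>the residue of -1 - x is p - 1 - r, with quotient -1 - x'\<close>
  have reflect: "-1 - (of_nat r + of_nat p * x') = of_nat (p - 1 - r) + of_nat p * (-1 - x')"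
    using assms(2) by (simp add: of_nat_diff algebra_simps)
  have "p_cong p 1 (c_coeff (of_nat r + of_nat p * x') p) (x' * (-1 - x'))"
    unfolding c_coeff_def reflect
    by (intro p_cong_mult p_cong_gbinomial_prime p assms) (use assms p in auto)
  then show ?thesis by (simp add: algebra_simps)
qed

text \<open>Both parities at once: 1 - X - (-1)^r is -X for even r and 2 - X = -(x-1)(x+2) for odd
  r. Taking r and x' as data lets the fractions -1/m be inserted directly.\<close>

lemma p_cong_sum_index_mult_G_poly:
  fixes x x' :: rat
  defines "X \<equiv> x * (x + 1)"
  assumes "odd p" "r < p" "x' \<in> p_integral p" "x = of_nat r + of_nat p * x'"
    and nonzero: "X * (X - 2) \<noteq> 0" and unit: "1 / (X * (X - 2)) \<in> p_integral p"
  shows "p_cong p 3 (\<Sum>n<p. of_nat n * G_poly n x)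
    (of_nat p ^ 2 * ((x' * (x' + 1) * (1 - X) + 1 - X - (-1) ^ r) / (X * (X - 2))))"
proof -
  define n where "n = p - 1"
  have n: "p = Suc n" using prime_gt_0_nat[OF p] by (simp add: n_def)
  define c where "c = c_coeff x"
  define V where "V = (\<Sum>k\<le>n. (X - 1 - of_nat (Suc k)) * c (Suc k))"
  define T where "T = (\<Sum>k\<le>n. (-1) ^ Suc k * of_nat (n choose k) * (X - 1 - of_nat (Suc k)) * c (Suc k))"
  define Z where "Z = x' * (x' + 1) * (1 - X) + 1 - X - (-1) ^ r"
  have x: "x \<in> p_integral p" using assms p by auto
  then have X: "X \<in> p_integral p" using p by (auto simp: X_def)
  have xr: "p_cong p 1 x (of_nat r)"
    by (rule p_congI[OF p, of _ _ x']) (use x p assms in auto)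
  have cp: "p_cong p 1 (c p) (- x' * (x' + 1))"
    unfolding c_def assms by (rule p_cong_c_coeff_prime) (use assms in auto)
  \<comment> \<open>\<open>p_cong\<close> includes integrality of both sides, so a reflexive
    congruence built from the two binomials yields membership for k < p; for k = p it comes from
    \<open>cp\<close>.\<close>
  have c: "c k \<in> p_integral p" if "k \<le> p" for k
  proof (cases "k = p")
    case True
    then show ?thesis using cp by (simp add: p_cong_def)
  next
    case False
    then have "p_cong p 1 (c k) (c k)"
      unfolding c_def c_coeff_def using that x p
      by (intro p_cong_mult p_cong_gbinomial p_cong_refl) auto
    then show ?thesis by (simp add: p_cong_def)
  qed
  \<comment> \<open>Modulo p the binomial is (-1)^k, so every sign becomes -1. The factor n = p - 1,
    also -1, then cancels it.\<close>
  have "p_cong p 1 T (- V)"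
    unfolding T_def V_def sum_negf[symmetric]
  proof (intro p_cong_sum p)
    fix k assume k: "k \<in> {..n}"
    have "p_cong p 1 ((-1) ^ Suc k * of_nat (n choose k) * ((X - 1 - of_nat (Suc k)) * c (Suc k)))
       ((-1) ^ Suc k * (-1) ^ k * ((X - 1 - of_nat (Suc k)) * c (Suc k)))"
      using k n p_cong_choose_pred[OF p, of k] X c[of "Suc k"] p
      by (intro p_cong_mult p_cong_refl) (auto simp: n_def[symmetric] simp del: of_nat_Suc)
    then show "p_cong p 1 ((-1) ^ Suc k * of_nat (n choose k) * (X - 1 - of_nat (Suc k)) * c (Suc k))
       (- ((X - 1 - of_nat (Suc k)) * c (Suc k)))"
      by (simp add: mult_ac power_mult_distrib[symmetric])
  qed
  moreover have "p_cong p 1 (of_nat n) (-1)"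
    by (rule p_congI[OF p, of _ _ 1]) (use p n in auto)
  ultimately have "p_cong p 1 (of_nat n * T) (-1 * - V)"
    by (intro p_cong_mult p)
  moreover have "p_cong p 1 V Z"
  proof -
    \<comment> \<open>The coefficient of c(p): X - 1 - p from the term k = p, and -p^2 from the sum
      of k c(k). The term X - 1 subtracted below is the one for k = 0, absent from
      \<open>V\<close>.\<close>
    define q where "q = X - 1 - of_nat p - (of_nat p)^2"
    have "V = (\<Sum>k<Suc p. (X - 1 - of_nat k) * c k) - (X - 1)"
      unfolding V_def sum.lessThan_Suc_shift using n by (simp add: lessThan_Suc_atMost c_def)
    also have "\<dots> = (X - 1) * (\<Sum>k<p. c k) - (\<Sum>k<p. of_nat k * c k) + (X - 1 - of_nat p) * c p - (X - 1)"
      by (simp add: sum_distrib_left sum_subtractf sum.distrib algebra_simps)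
    also have "(\<Sum>k<p. of_nat k * c k) = X * (\<Sum>k<p. c k) + (of_nat p)^2 * c p"
      unfolding c_def X_def by (rule sum_index_mult_c_coeff)
    finally have V: "V = - 1 * (\<Sum>k<p. c k) + q * c p - (X - 1)"
      by (simp add: q_def algebra_simps)
    have "p_cong p 1 q (X - 1)"
      by (rule p_congI[OF p, of _ _ "- 1 - of_nat p"]) (use X p in \<open>auto simp: q_def algebra_simps power2_eq_square\<close>)
    then have "p_cong p 1 V (- 1 * (-1) ^ r + (X - 1) * (- x' * (x' + 1)) - (X - 1))"
      unfolding V
      using p_cong_sum_c_coeff[OF assms(3) xr] cp X p
      by (intro p_cong_diff p_cong_add p_cong_mult p_cong_refl) (auto simp: c_def)
    also have "- 1 * (-1) ^ r + (X - 1) * (- x' * (x' + 1)) - (X - 1) = Z"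
      by (simp add: Z_def algebra_simps)
    finally show ?thesis .
  qed
  ultimately have "p_cong p 1 (of_nat n * T) Z"
    by (auto intro: p_cong_trans p)
  then have "p_cong p (2 + 1) (of_nat p ^ 2 * (of_nat n * T)) (of_nat p ^ 2 * Z)"
    by (intro p_cong_power_mult p)
  then have "p_cong p 3 (1 / (X * (X - 2)) * (of_nat p ^ 2 * (of_nat n * T))) (1 / (X * (X - 2)) * (of_nat p ^ 2 * Z))"
    using p_cong_cmult[OF p unit] by simp
  moreover have "X * (X - 2) * (\<Sum>m<p. of_nat m * G_poly m x) = of_nat p ^ 2 * (of_nat n * T)"
    using sum_index_mult_G_poly_closed[of x n] by (simp only: X_def T_def c_def n mult_ac)
  then have "(\<Sum>m<p. of_nat m * G_poly m x) = 1 / (X * (X - 2)) * (of_nat p ^ 2 * (of_nat n * T))"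
    using nonzero by (simp add: eq_divide_eq mult_ac)
  ultimately show ?thesis
    by (simp add: Z_def)
qed

end

section \<open>The four integer sequences as scaled values of G_n\<close>

lemma sum_choose_mult_power_eq_G_poly:
  fixes M :: rat
  assumes "M \<noteq> 0" and a: "\<And>k. a k = M ^ k * c_coeff x k"
  shows "(\<Sum>k\<le>n. of_nat (n choose k) * (-1) ^ k * a k * M ^ (n - k)) / M ^ n = G_poly n x"
  unfolding G_poly_def sum_divide_distrib
proof (rule sum.cong)
  fix k assume "k \<in> {..n}"
  then have "M ^ n = M ^ k * M ^ (n - k)" by (simp flip: power_add)
  then show "of_nat (n choose k) * (-1) ^ k * a k * M ^ (n - k) / M ^ n
      = of_nat (n choose k) * (-1) ^ k * (x gchoose k) * ((-1 - x) gchoose k)"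
    using assms by (simp add: c_coeff_def)
qed simp

text \<open>Both sides satisfy the same first-order recurrence, whose leading coefficient (k+1)^2
  never vanishes.\<close>

lemma eq_power_mult_c_coeffI:
  assumes "a 0 = 1"
    and rec: "\<And>k. (of_nat k + 1)^2 * a (Suc k) = M * (of_nat k * (of_nat k + 1) - x * (x + 1)) * a k"
  shows "a k = M ^ k * c_coeff x k"
proof (induction k)
  case 0
  then show ?case using assms(1) by simp
next
  case (Suc k)
  have "(of_nat k + 1)^2 * a (Suc k) = M ^ Suc k * ((of_nat k * (of_nat k + 1) - x * (x + 1)) * c_coeff x k)"
    unfolding rec Suc.IH by simp
  also have "\<dots> = (of_nat k + 1)^2 * (M ^ Suc k * c_coeff x (Suc k))"
    unfolding c_coeff_Suc[symmetric] by simp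
  finally show ?case by (simp add: add_eq_0_iff flip: of_nat_Suc)
qed

lemma fact_mult_Suc:
  "fact (2 * Suc k) = (2 * of_nat k + 2) * (2 * of_nat k + 1) * (fact (2 * k) :: rat)"
  "fact (3 * Suc k) = (3 * of_nat k + 3) * (3 * of_nat k + 2) * (3 * of_nat k + 1) * (fact (3 * k) :: rat)"
  "fact (4 * Suc k) = (4 * of_nat k + 4) * (4 * of_nat k + 3) * (4 * of_nat k + 2) * (4 * of_nat k + 1) * (fact (4 * k) :: rat)"
  "fact (6 * Suc k) = (6 * of_nat k + 6) * (6 * of_nat k + 5) * (6 * of_nat k + 4) * (6 * of_nat k + 3) * (6 * of_nat k + 2) * (6 * of_nat k + 1) * (fact (6 * k) :: rat)"
proof -
  have "2 * Suc k = Suc (Suc (2 * k))" "3 * Suc k = Suc (Suc (Suc (3 * k)))"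
    "4 * Suc k = Suc (Suc (Suc (Suc (4 * k))))" "6 * Suc k = Suc (Suc (Suc (Suc (Suc (Suc (6 * k))))))"
    by simp_all
  note * = this
  show "fact (2 * Suc k) = (2 * of_nat k + 2) * (2 * of_nat k + 1) * (fact (2 * k) :: rat)"
    "fact (3 * Suc k) = (3 * of_nat k + 3) * (3 * of_nat k + 2) * (3 * of_nat k + 1) * (fact (3 * k) :: rat)"
    "fact (4 * Suc k) = (4 * of_nat k + 4) * (4 * of_nat k + 3) * (4 * of_nat k + 2) * (4 * of_nat k + 1) * (fact (4 * k) :: rat)"
    "fact (6 * Suc k) = (6 * of_nat k + 6) * (6 * of_nat k + 5) * (6 * of_nat k + 4) * (6 * of_nat k + 3) * (6 * of_nat k + 2) * (6 * of_nat k + 1) * (fact (6 * k) :: rat)"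
    unfolding * fact_Suc by (simp_all add: ac_simps)
qed

lemma of_nat_mult_add_nz: "(of_nat k + 1 :: rat) \<noteq> 0" "(2 * of_nat k + 1 :: rat) \<noteq> 0" "(3 * of_nat k + 1 :: rat) \<noteq> 0" "(3 * of_nat k + 2 :: rat) \<noteq> 0" "(2 * of_nat k + 2 :: rat) \<noteq> 0" "(3 * of_nat k + 3 :: rat) \<noteq> 0"
  using of_nat_0_le_iff[of k, where 'a=rat] by linarith+

lemma choose_products:
  "of_nat ((2 * k) choose k) = (fact (2 * k) / (fact k * fact k) :: rat)"
  "of_nat ((3 * k) choose k) = (fact (3 * k) / (fact k * fact (2 * k)) :: rat)"
  "of_nat ((4 * k) choose (2 * k)) = (fact (4 * k) / (fact (2 * k) * fact (2 * k)) :: rat)"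
  "of_nat ((6 * k) choose (3 * k)) = (fact (6 * k) / (fact (3 * k) * fact (3 * k)) :: rat)"
  by (simp_all add: binomial_fact flip: diff_mult_distrib)

text \<open>For x = -1/m one has k (k+1) - X = (k + 1/m) (k + 1 - 1/m). Times 16, 27, 64, 432 this
  is 4 (2k+1)^2, 3 (3k+1)(3k+2), 4 (4k+1)(4k+3), 12 (6k+1)(6k+5), the ratios of successive binomial
  products up to (k+1)^2.\<close>

lemma power_mult_c_coeff:
  "of_nat ((2 * k) choose k) ^ 2 = 16 ^ k * c_coeff (- (1 / 2)) k"
  "of_nat ((2 * k) choose k) * of_nat ((3 * k) choose k) = 27 ^ k * c_coeff (- (1 / 3)) k"
  "of_nat ((2 * k) choose k) * of_nat ((4 * k) choose (2 * k)) = 64 ^ k * c_coeff (- (1 / 4)) k"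
  "of_nat ((3 * k) choose k) * of_nat ((6 * k) choose (3 * k)) = 432 ^ k * c_coeff (- (1 / 6)) k"
proof -
  define t :: "nat \<Rightarrow> rat" where "t k = of_nat k" for k
  note nz = of_nat_mult_add_nz[folded t_def]
  have *: "(2 * t k + 2) = 2 * (t k + 1)" "3 * t k + 3 = 3 * (t k + 1)" "4 * t k + 4 = 4 * (t k + 1)"
     "4 * t k + 2 = 2 * (2 * t k + 1)" "6 * t k + 6 = 6 * (t k + 1)" "6 * t k + 4 = 2 * (3 * t k + 2)"
     "6 * t k + 3 = 3 * (2 * t k + 1)" "6 * t k + 2 = 2 * (3 * t k + 1)" for k
    by simp_all
  have f: "fact (Suc k) = (t k + 1) * (fact k :: rat)" for k by (simp add: t_def add_ac)
  note facts = fact_mult_Suc[folded t_def, unfolded *] f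
  show "of_nat ((2 * k) choose k) ^ 2 = 16 ^ k * c_coeff (- (1 / 2)) k"
    by (rule eq_power_mult_c_coeffI[where a = "\<lambda>k. of_nat ((2 * k) choose k) ^ 2"], simp, unfold choose_products, fold t_def, unfold facts)
       (simp add: divide_simps nz power2_eq_square, simp add: algebra_simps)
  show "of_nat ((2 * k) choose k) * of_nat ((3 * k) choose k) = 27 ^ k * c_coeff (- (1 / 3)) k"
    by (rule eq_power_mult_c_coeffI[where a = "\<lambda>k. of_nat ((2 * k) choose k) * of_nat ((3 * k) choose k)"], simp, unfold choose_products, fold t_def, unfold facts)
       (simp add: divide_simps nz power2_eq_square, simp add: algebra_simps)
  show "of_nat ((2 * k) choose k) * of_nat ((4 * k) choose (2 * k)) = 64 ^ k * c_coeff (- (1 / 4)) k"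
    by (rule eq_power_mult_c_coeffI[where a = "\<lambda>k. of_nat ((2 * k) choose k) * of_nat ((4 * k) choose (2 * k))"], simp, unfold choose_products, fold t_def, unfold facts)
       (simp add: divide_simps nz power2_eq_square, simp add: algebra_simps)
  show "of_nat ((3 * k) choose k) * of_nat ((6 * k) choose (3 * k)) = 432 ^ k * c_coeff (- (1 / 6)) k"
    by (rule eq_power_mult_c_coeffI[where a = "\<lambda>k. of_nat ((3 * k) choose k) * of_nat ((6 * k) choose (3 * k))"], simp, unfold choose_products, fold t_def, unfold facts)
       (simp add: divide_simps nz power2_eq_square, simp add: algebra_simps)
qed

lemma G_seq_eq_G_poly:
  "of_int (G_seq n) / 16 ^ n = G_poly n (- (1 / 2))"
  "of_int (G3_seq n) / 27 ^ n = G_poly n (- (1 / 3))"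
  "of_int (G4_seq n) / 64 ^ n = G_poly n (- (1 / 4))"
  "of_int (G6_seq n) / 432 ^ n = G_poly n (- (1 / 6))"
proof -
  show "of_int (G_seq n) / 16 ^ n = G_poly n (- (1 / 2))"
    by (subst sum_choose_mult_power_eq_G_poly[symmetric, OF _ power_mult_c_coeff(1)])
       (simp_all add: G_seq_def)
  show "of_int (G3_seq n) / 27 ^ n = G_poly n (- (1 / 3))"
    by (subst sum_choose_mult_power_eq_G_poly[symmetric, OF _ power_mult_c_coeff(2)])
       (simp_all add: G3_seq_def mult.assoc)
  show "of_int (G4_seq n) / 64 ^ n = G_poly n (- (1 / 4))"
    by (subst sum_choose_mult_power_eq_G_poly[symmetric, OF _ power_mult_c_coeff(3)])
       (simp_all add: G4_seq_def mult.assoc)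
  show "of_int (G6_seq n) / 432 ^ n = G_poly n (- (1 / 6))"
    by (subst sum_choose_mult_power_eq_G_poly[symmetric, OF _ power_mult_c_coeff(4)])
       (simp_all add: G6_seq_def mult.assoc)
qed

section \<open>The arguments x = -1/m and the residue classes of p\<close>

text \<open>From m r + 1 = s p follows x = r - (s/m) p, so x' = -s/m. For s = 1 and s = m - 1 alike
  x'(x'+1) = X, and the numerator becomes 1 - X^2 - (-1)^r. These s suffice for m = 2, 3, 4, 6,
  where the only units modulo m are 1 and -1.\<close>

lemma p_cong_sum_index_mult_G_poly_unit_fraction:
  fixes m :: nat
  defines "x \<equiv> - (1 / of_nat m) :: rat"
  defines "X \<equiv> x * (x + 1)"
  assumes p: "prime p" "odd p" and m: "m * r + 1 = p \<or> m * r + 1 = (m - 1) * p" "1 < m"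
    and D: "X * (X - 2) \<noteq> 0" "1 / (X * (X - 2)) \<in> p_integral p"
  shows "p_cong p 3 (\<Sum>n=0..p-1. of_nat n * G_poly n x)
    (of_nat p ^ 2 * ((1 - X * X - (-1) ^ r) / (X * (X - 2))))"
proof -
  obtain s where s: "m * r + 1 = s * p" "s = 1 \<or> s + 1 = m" "1 < m"
  proof (cases "m * r + 1 = p")
    case True
    then show ?thesis using that[of 1] m by simp
  next
    case False
    then show ?thesis using that[of "m - 1"] m by simp
  qed
  define x' :: rat where "x' = - (of_nat s / of_nat m)"
  have "m * r < m * p" using s by (metis add_lessD1 le_less mult_le_mono1 less_add_one less_imp_le order.strict_trans2)
  then have r: "r < p" by simp
  have "\<not> p dvd m"
  proof
    assume "p dvd m"
    then have "p dvd m * r" "p dvd m * r + 1" unfolding s by simp_all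
    then have "p dvd 1" by (metis dvd_add_right_iff)
    then show False using p by simp
  qed
  then have "\<not> int p dvd int m" by simp
  from p_integral_div_of_int[OF p(1) p_integral_of_nat[OF p(1)] this] have x': "x' \<in> p_integral p"
    using p by (simp add: x'_def)
  have "(of_nat (m * r + 1) :: rat) = of_nat (s * p)" by (simp only: s)
  then have x: "x = of_nat r + of_nat p * x'"
    using s(3) by (simp add: x_def x'_def field_simps)
  have "x' * (x' + 1) = X"
    using s(2,3) by (auto simp: x'_def X_def x_def field_simps)
  moreover have "{0..p-1} = {..<p}" using prime_gt_0_nat[OF p(1)] by auto
  ultimately show ?thesis
    using p_cong_sum_index_mult_G_poly[OF p r x' x D[unfolded X_def], folded X_def]
    by (simp add: algebra_simps)
qed

text \<open>The numerators of X (X-2) = 9/16, 40/81, 105/256, 385/1296 for m = 2, 3, 4, 6.\<close>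

lemma not_dvd_prime_products:
  fixes p :: nat
  assumes "prime p" "p > 3"
  shows "\<not> int p dvd 9" "p \<noteq> 5 \<Longrightarrow> \<not> int p dvd 40"
    "p \<noteq> 5 \<Longrightarrow> p \<noteq> 7 \<Longrightarrow> \<not> int p dvd 105"
    "p \<noteq> 5 \<Longrightarrow> p \<noteq> 7 \<Longrightarrow> p \<noteq> 11 \<Longrightarrow> \<not> int p dvd 385"
proof -
  have prime_dvd: "p dvd q \<longleftrightarrow> p = q" if "prime q" for q
    using primes_dvd_imp_eq[OF assms(1) that] by auto
  have small: "prime (2::nat)" "prime (3::nat)" "prime (5::nat)" "prime (7::nat)" "prime (11::nat)"
    by simp_all
  have "9 = 3 * (3::nat)" "40 = 2 * 2 * 2 * (5::nat)" "105 = 3 * 5 * (7::nat)" "385 = 5 * 7 * (11::nat)"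
    by simp_all
  note factors = this
  have "\<not> p dvd 9" "p \<noteq> 5 \<Longrightarrow> \<not> p dvd 40"
    "p \<noteq> 5 \<Longrightarrow> p \<noteq> 7 \<Longrightarrow> \<not> p dvd 105"
    "p \<noteq> 5 \<Longrightarrow> p \<noteq> 7 \<Longrightarrow> p \<noteq> 11 \<Longrightarrow> \<not> p dvd 385"
    unfolding factors prime_dvd_mult_iff[OF assms(1)] prime_dvd[OF small(1)] prime_dvd[OF small(2)]
      prime_dvd[OF small(3)] prime_dvd[OF small(4)] prime_dvd[OF small(5)]
    using assms(2) by auto
  then show "\<not> int p dvd 9" "p \<noteq> 5 \<Longrightarrow> \<not> int p dvd 40"
    "p \<noteq> 5 \<Longrightarrow> p \<noteq> 7 \<Longrightarrow> \<not> int p dvd 105"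
    "p \<noteq> 5 \<Longrightarrow> p \<noteq> 7 \<Longrightarrow> p \<noteq> 11 \<Longrightarrow> \<not> int p dvd 385"
    by (simp_all flip: int_dvd_int_iff)
qed

lemma cong_natE:
  fixes a m n :: nat
  assumes "[n = a] (mod m)" "a < m"
  obtains q where "n = m * q + a"
proof -
  have "n mod m = a" using assms by (simp add: cong_def)
  then show thesis using that[of "n div m"] mult_div_mod_eq[of m n] by simp
qed

text \<open>The parity of r = (p-1)/4 or (3p-1)/4 depends on p modulo 8.\<close>

lemma cong_4_imp:
  fixes p :: nat
  shows "[p = 1] (mod 8) \<or> [p = 3] (mod 8) \<Longrightarrow> \<exists>r. (4 * r + 1 = p \<or> 4 * r + 1 = 3 * p) \<and> even r"
    and "[p = 5] (mod 8) \<or> [p = 7] (mod 8) \<Longrightarrow> \<exists>r. (4 * r + 1 = p \<or> 4 * r + 1 = 3 * p) \<and> odd r"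
proof -
  assume "[p = 1] (mod 8) \<or> [p = 3] (mod 8)"
  then show "\<exists>r. (4 * r + 1 = p \<or> 4 * r + 1 = 3 * p) \<and> even r"
  proof (elim disjE)
    assume "[p = 1] (mod 8)"
    then obtain q where "p = 8 * q + 1" by (rule cong_natE) simp
    then show ?thesis by (intro exI[of _ "2 * q"]) simp
  next
    assume "[p = 3] (mod 8)"
    then obtain q where "p = 8 * q + 3" by (rule cong_natE) simp
    then show ?thesis by (intro exI[of _ "6 * q + 2"]) simp
  qed
next
  assume "[p = 5] (mod 8) \<or> [p = 7] (mod 8)"
  then show "\<exists>r. (4 * r + 1 = p \<or> 4 * r + 1 = 3 * p) \<and> odd r"
  proof (elim disjE)
    assume "[p = 5] (mod 8)"
    then obtain q where "p = 8 * q + 5" by (rule cong_natE) simp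
    then show ?thesis by (intro exI[of _ "2 * q + 1"]) simp
  next
    assume "[p = 7] (mod 8)"
    then obtain q where "p = 8 * q + 7" by (rule cong_natE) simp
    then show ?thesis by (intro exI[of _ "6 * q + 5"]) simp
  qed
qed

text \<open>The parity of r = (p-1)/6 or (5p-1)/6 depends on p modulo 12; since 3 does not divide p,
  its class modulo 4 already decides it.\<close>

lemma cong_6_imp:
  fixes p :: nat
  assumes "\<not> 3 dvd p"
  shows "[p = 1] (mod 4) \<Longrightarrow> \<exists>r. (6 * r + 1 = p \<or> 6 * r + 1 = 5 * p) \<and> even r"
    and "[p = 3] (mod 4) \<Longrightarrow> \<exists>r. (6 * r + 1 = p \<or> 6 * r + 1 = 5 * p) \<and> odd r"
proof -
  have three: "\<exists>t. q = 3 * t \<or> q = 3 * t + 1 \<or> q = 3 * t + 2" for q :: nat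
    by presburger
  assume "[p = 1] (mod 4)"
  then obtain q where "p = 4 * q + 1" by (rule cong_natE) simp
  moreover obtain t where "q = 3 * t \<or> q = 3 * t + 1 \<or> q = 3 * t + 2" using three by blast
  ultimately have "p = 12 * t + 1 \<or> p = 12 * t + 5 \<or> p = 3 * (4 * t + 3)" by auto
  then have "p = 12 * t + 1 \<or> p = 12 * t + 5" using assms by auto
  then show "\<exists>r. (6 * r + 1 = p \<or> 6 * r + 1 = 5 * p) \<and> even r"
  proof
    assume "p = 12 * t + 1"
    then show ?thesis by (intro exI[of _ "2 * t"]) simp
  next
    assume "p = 12 * t + 5"
    then show ?thesis by (intro exI[of _ "10 * t + 4"]) simp
  qed
next
  have three: "\<exists>t. q = 3 * t \<or> q = 3 * t + 1 \<or> q = 3 * t + 2" for q :: nat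
    by presburger
  assume "[p = 3] (mod 4)"
  then obtain q where "p = 4 * q + 3" by (rule cong_natE) simp
  moreover obtain t where "q = 3 * t \<or> q = 3 * t + 1 \<or> q = 3 * t + 2" using three by blast
  ultimately have "p = 12 * t + 7 \<or> p = 12 * t + 11 \<or> p = 3 * (4 * t + 1)" by auto
  then have "p = 12 * t + 7 \<or> p = 12 * t + 11" using assms by auto
  then show "\<exists>r. (6 * r + 1 = p \<or> 6 * r + 1 = 5 * p) \<and> odd r"
  proof
    assume "p = 12 * t + 7"
    then show ?thesis by (intro exI[of _ "2 * t + 1"]) simp
  next
    assume "p = 12 * t + 11"
    then show ?thesis by (intro exI[of _ "10 * t + 9"]) simp
  qed
qed
text \<open>Here the denominator X (X - 2) = 385/1296 is not invertible modulo p, so the general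
  argument does not apply.\<close>

lemma G6_seq_5:
  "p_cong 5 3 (\<Sum>n=0..4. of_nat n * of_int (G6_seq n) / 432 ^ n) (- (5 / 77) * of_nat 5 ^ 2)"
proof -
  have five: "prime (5::nat)" by simp
  have "G6_seq 1 = 372" "G6_seq 2 = 148644" "G6_seq 3 = 60907728" "G6_seq 4 = 25280259876"
    by (simp_all add: G6_seq_def atMost_nat_numeral atMost_Suc binomial_fact' fact_numeral)
  moreover have "{0..4::nat} = {0, 1, 2, 3, 4}" by auto
  ultimately have S: "(\<Sum>n=0..4. of_nat n * of_int (G6_seq n) / 432 ^ n) = (of_int 1843956625 / of_int 241864704 :: rat)"
    by simp
  show ?thesis
    unfolding S
  \<comment> \<open>The right side is -125/77, so both sides are 0 modulo 5^3. The witness is their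
    difference divided by 125, with denominator 77 * 241864704.\<close>
  proof (rule p_congI[OF five, of _ _ "of_int 1377741985 / of_int 18623582208"])
    show "(of_int 1843956625 / of_int 241864704 :: rat) \<in> p_integral 5"
      "(of_int 1377741985 / of_int 18623582208 :: rat) \<in> p_integral 5"
      by (rule p_integral_div_of_int[OF five]; simp add: p_integral_numeral[OF five])+
    show "- (5 / 77) * (of_nat 5)\<^sup>2 \<in> p_integral 5"
      using p_integral_div_of_int[OF five p_integral_of_int[OF five, of "-125"], of 77] by simp
  qed simp
qed

theorem theorem3p3:
  shows "(\<forall>(p::nat) (x::rat) (x'::rat).
      prime p \<and> odd p \<and> x \<in> p_integral p \<and>
      \<not> p_cong p 1 ((x - 1) * x * (x + 1) * (x + 2)) 0 \<and>
      x' = (x - of_nat (p_residue p x)) / of_nat p \<longrightarrow>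
        (even (p_residue p x) \<longrightarrow>
          p_cong p 3 (\<Sum>n=0..p-1. of_nat n * G_poly n x)
            (of_nat p ^ 2 * ((x' * (x' + 1) * (1 - x * (x + 1)) - x * (x + 1))
               / ((x - 1) * x * (x + 1) * (x + 2))))) \<and>
        (odd (p_residue p x) \<longrightarrow>
          p_cong p 3 (\<Sum>n=0..p-1. of_nat n * G_poly n x)
            (of_nat p ^ 2 * ((x' * (x' + 1) * (1 - x * (x + 1)) - (x - 1) * (x + 2))
               / ((x - 1) * x * (x + 1) * (x + 2))))))
    \<and>
    (\<forall>p::nat. prime p \<and> p > 3 \<longrightarrow>
        ([p = 1] (mod 4) \<longrightarrow>
          p_cong p 3 (\<Sum>n=0..p-1. of_nat n * of_int (G_seq n) / 16 ^ n)
            (- (1 / 9) * of_nat p ^ 2)) \<and>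
        ([p = 3] (mod 4) \<longrightarrow>
          p_cong p 3 (\<Sum>n=0..p-1. of_nat n * of_int (G_seq n) / 16 ^ n)
            (31 / 9 * of_nat p ^ 2)) \<and>
        ([p = 1] (mod 3) \<longrightarrow>
          p_cong p 3 (\<Sum>n=0..p-1. of_nat n * of_int (G3_seq n) / 27 ^ n)
            (- (1 / 10) * of_nat p ^ 2)) \<and>
        ([p = 2] (mod 3) \<and> p \<noteq> 5 \<longrightarrow>
          p_cong p 3 (\<Sum>n=0..p-1. of_nat n * of_int (G3_seq n) / 27 ^ n)
            (79 / 20 * of_nat p ^ 2)) \<and>
        ([p = 1] (mod 8) \<or> [p = 3] (mod 8) \<longrightarrow>
          p_cong p 3 (\<Sum>n=0..p-1. of_nat n * of_int (G4_seq n) / 64 ^ n)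
            (- (3 / 35) * of_nat p ^ 2)) \<and>
        (([p = 5] (mod 8) \<or> [p = 7] (mod 8)) \<and> p \<noteq> 5 \<and> p \<noteq> 7 \<longrightarrow>
          p_cong p 3 (\<Sum>n=0..p-1. of_nat n * of_int (G4_seq n) / 64 ^ n)
            (503 / 105 * of_nat p ^ 2)) \<and>
        ([p = 1] (mod 4) \<longrightarrow>
          p_cong p 3 (\<Sum>n=0..p-1. of_nat n * of_int (G6_seq n) / 432 ^ n)
            (- (5 / 77) * of_nat p ^ 2)) \<and>
        ([p = 3] (mod 4) \<and> p \<noteq> 7 \<and> p \<noteq> 11 \<longrightarrow>
          p_cong p 3 (\<Sum>n=0..p-1. of_nat n * of_int (G6_seq n) / 432 ^ n)
            (2567 / 385 * of_nat p ^ 2)))"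
proof (intro conjI allI impI)
  fix p :: nat and x x' :: rat
  assume *: "prime p \<and> odd p \<and> x \<in> p_integral p \<and>
      \<not> p_cong p 1 ((x - 1) * x * (x + 1) * (x + 2)) 0 \<and>
      x' = (x - of_nat (p_residue p x)) / of_nat p"
  then have p: "prime p" "odd p" and x: "x \<in> p_integral p"
    and D: "\<not> p_cong p 1 ((x - 1) * x * (x + 1) * (x + 2)) 0"
    and x': "x' = (x - of_nat (p_residue p x)) / of_nat p" by auto
  define r where "r = p_residue p x"
  have r: "r < p" "p_cong p 1 x (of_nat r)"
    using p_residue[OF p(1) x] by (simp_all add: r_def)
  have p0: "(of_nat p :: rat) \<noteq> 0" using p by auto
  have D_eq: "(x - 1) * x * (x + 1) * (x + 2) = x * (x + 1) * (x * (x + 1) - 2)"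
    by (simp add: algebra_simps)
  have "x' \<in> p_integral p"
    using r(2) p0 by (auto simp: p_cong_def x' r_def[symmetric])
  moreover have "x = of_nat r + of_nat p * x'"
    using p0 by (simp add: x' r_def)
  moreover have "x * (x + 1) * (x * (x + 1) - 2) \<noteq> 0"
    using D p_cong_refl[OF p(1) p_integral_numeral(1)[OF p(1)], of 1] by (auto simp: D_eq)
  moreover have "1 / (x * (x + 1) * (x * (x + 1) - 2)) \<in> p_integral p"
    unfolding D_eq[symmetric] using D x p by (intro inverse_p_integral) auto
  ultimately have main: "p_cong p 3 (\<Sum>n<p. of_nat n * G_poly n x)
    (of_nat p ^ 2 * ((x' * (x' + 1) * (1 - x * (x + 1)) + 1 - x * (x + 1) - (-1) ^ r)
      / ((x - 1) * x * (x + 1) * (x + 2))))"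
    unfolding D_eq by (rule p_cong_sum_index_mult_G_poly[OF p r(1)])
  have range: "{0..p-1} = {..<p}" using prime_gt_0_nat[OF p(1)] by auto
  show "p_cong p 3 (\<Sum>n=0..p-1. of_nat n * G_poly n x)
            (of_nat p ^ 2 * ((x' * (x' + 1) * (1 - x * (x + 1)) - x * (x + 1))
               / ((x - 1) * x * (x + 1) * (x + 2))))" if "even (p_residue p x)"
  proof -
    have "x' * (x' + 1) * (1 - x * (x + 1)) + 1 - x * (x + 1) - (-1) ^ r
        = x' * (x' + 1) * (1 - x * (x + 1)) - x * (x + 1)"
      using that by (simp add: r_def)
    with main range show ?thesis by (simp only:)
  qed
  show "p_cong p 3 (\<Sum>n=0..p-1. of_nat n * G_poly n x)
            (of_nat p ^ 2 * ((x' * (x' + 1) * (1 - x * (x + 1)) - (x - 1) * (x + 2))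
               / ((x - 1) * x * (x + 1) * (x + 2))))" if "odd (p_residue p x)"
  proof -
    have "x' * (x' + 1) * (1 - x * (x + 1)) + 1 - x * (x + 1) - (-1) ^ r
        = x' * (x' + 1) * (1 - x * (x + 1)) - (x - 1) * (x + 2)"
      using that by (simp add: r_def algebra_simps)
    with main range show ?thesis by (simp only:)
  qed
next
  fix p :: nat
  assume "prime p \<and> p > 3"
  then have p: "prime p" "p > 3" by auto
  then have odd: "odd p" using prime_odd_nat[of p] by simp
  have not3: "\<not> 3 dvd p"
    using p primes_dvd_imp_eq[of 3 p] by auto
  note unit_fraction = p_cong_sum_index_mult_G_poly_unit_fraction[OF p(1) odd]
  note nd = not_dvd_prime_products[OF p]
  have sums: "a * of_int (G_seq n) / 16 ^ n = a * G_poly n (- (1 / 2))"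
    "a * of_int (G3_seq n) / 27 ^ n = a * G_poly n (- (1 / 3))"
    "a * of_int (G4_seq n) / 64 ^ n = a * G_poly n (- (1 / 4))"
    "a * of_int (G6_seq n) / 432 ^ n = a * G_poly n (- (1 / 6))" for a :: rat and n
    by (simp_all flip: G_seq_eq_G_poly)
  show "p_cong p 3 (\<Sum>n=0..p-1. of_nat n * of_int (G_seq n) / 16 ^ n) (- (1 / 9) * of_nat p ^ 2)"
    if c: "[p = 1] (mod 4)"
  proof -
    have "\<exists>r. 2 * r + 1 = p \<and> even r"
      using c odd unfolding cong_def by presburger
    then obtain r where r: "2 * r + 1 = p \<or> 2 * r + 1 = (2 - 1) * p" "even r"
      by auto
    have unit: "of_int 16 / of_int 9 \<in> p_integral p"
      by (rule p_integral_div_of_int[OF p(1) p_integral_of_int[OF p(1)] nd(1)])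
    show ?thesis
      \<comment> \<open>For even r the quotient is -X/(X-2), here -1/9 at X = -1/4.\<close>
      using unit_fraction[OF r(1)] unit r(2) by (simp add: sums mult_ac)
  qed
  show "p_cong p 3 (\<Sum>n=0..p-1. of_nat n * of_int (G_seq n) / 16 ^ n) (31 / 9 * of_nat p ^ 2)"
    if c: "[p = 3] (mod 4)"
  proof -
    have "\<exists>r. 2 * r + 1 = p \<and> odd r"
      using c odd unfolding cong_def by presburger
    then obtain r where r: "2 * r + 1 = p \<or> 2 * r + 1 = (2 - 1) * p" "odd r"
      by auto
    have unit: "of_int 16 / of_int 9 \<in> p_integral p"
      by (rule p_integral_div_of_int[OF p(1) p_integral_of_int[OF p(1)] nd(1)])
    show ?thesis
      \<comment> \<open>For odd r the quotient is (2 - X^2)/(X (X-2)), here 31/9.\<close>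
      using unit_fraction[OF r(1)] unit r(2) by (simp add: sums mult_ac)
  qed
  show "p_cong p 3 (\<Sum>n=0..p-1. of_nat n * of_int (G3_seq n) / 27 ^ n) (- (1 / 10) * of_nat p ^ 2)"
    if c: "[p = 1] (mod 3)"
  proof -
    \<comment> \<open>r = (p-1)/3 is even because p is odd.\<close>
    have "\<exists>r. 3 * r + 1 = p \<and> even r"
      using c odd unfolding cong_def by presburger
    then obtain r where r: "3 * r + 1 = p \<or> 3 * r + 1 = (3 - 1) * p" "even r"
      by auto
    have unit: "of_int 81 / of_int 40 \<in> p_integral p"
      by (rule p_integral_div_of_int[OF p(1) p_integral_of_int[OF p(1)] nd(2)]; use c in \<open>auto simp: cong_def\<close>)
    show ?thesis
      using unit_fraction[OF r(1)] unit r(2) by (simp add: sums mult_ac)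
  qed
  show "p_cong p 3 (\<Sum>n=0..p-1. of_nat n * of_int (G3_seq n) / 27 ^ n) (79 / 20 * of_nat p ^ 2)"
    if c: "[p = 2] (mod 3) \<and> p \<noteq> 5"
  proof -
    \<comment> \<open>Now s = 2, and r is odd because 3 r = 2 p - 1 is.\<close>
    have "\<exists>r. 3 * r + 1 = 2 * p \<and> odd r"
      using c odd unfolding cong_def by presburger
    then obtain r where r: "3 * r + 1 = p \<or> 3 * r + 1 = (3 - 1) * p" "odd r"
      by auto
    have unit: "of_int 81 / of_int 40 \<in> p_integral p"
      by (rule p_integral_div_of_int[OF p(1) p_integral_of_int[OF p(1)] nd(2)]; use c in \<open>auto simp: cong_def\<close>)
    show ?thesis
      using unit_fraction[OF r(1)] unit r(2) by (simp add: sums mult_ac)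
  qed
  show "p_cong p 3 (\<Sum>n=0..p-1. of_nat n * of_int (G4_seq n) / 64 ^ n) (- (3 / 35) * of_nat p ^ 2)"
    if c: "[p = 1] (mod 8) \<or> [p = 3] (mod 8)"
  proof -
    have "\<exists>r. (4 * r + 1 = p \<or> 4 * r + 1 = 3 * p) \<and> even r"
      using c cong_4_imp(1) by blast
    then obtain r where r: "4 * r + 1 = p \<or> 4 * r + 1 = (4 - 1) * p" "even r"
      by auto
    have unit: "of_int 256 / of_int 105 \<in> p_integral p"
      by (rule p_integral_div_of_int[OF p(1) p_integral_of_int[OF p(1)] nd(3)]; use c in \<open>auto simp: cong_def\<close>)
    show ?thesis
      using unit_fraction[OF r(1)] unit r(2) by (simp add: sums mult_ac)
  qed
  show "p_cong p 3 (\<Sum>n=0..p-1. of_nat n * of_int (G4_seq n) / 64 ^ n) (503 / 105 * of_nat p ^ 2)"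
    if c: "([p = 5] (mod 8) \<or> [p = 7] (mod 8)) \<and> p \<noteq> 5 \<and> p \<noteq> 7"
  proof -
    have "\<exists>r. (4 * r + 1 = p \<or> 4 * r + 1 = 3 * p) \<and> odd r"
      using c cong_4_imp(2) by blast
    then obtain r where r: "4 * r + 1 = p \<or> 4 * r + 1 = (4 - 1) * p" "odd r"
      by auto
    have unit: "of_int 256 / of_int 105 \<in> p_integral p"
      by (rule p_integral_div_of_int[OF p(1) p_integral_of_int[OF p(1)] nd(3)]; use c in \<open>auto simp: cong_def\<close>)
    show ?thesis
      using unit_fraction[OF r(1)] unit r(2) by (simp add: sums mult_ac)
  qed
  show "p_cong p 3 (\<Sum>n=0..p-1. of_nat n * of_int (G6_seq n) / 432 ^ n) (- (5 / 77) * of_nat p ^ 2)"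
    if c: "[p = 1] (mod 4)"
  proof (cases "p = 5")
    case True
    then show ?thesis using G6_seq_5 by simp
  next
    case False
    have "\<exists>r. (6 * r + 1 = p \<or> 6 * r + 1 = 5 * p) \<and> even r"
      using c cong_6_imp(1)[OF not3] by blast
    then obtain r where r: "6 * r + 1 = p \<or> 6 * r + 1 = (6 - 1) * p" "even r"
      by auto
    have unit: "of_int 1296 / of_int 385 \<in> p_integral p"
      \<comment> \<open>Of the primes 5, 7, 11 dividing 385, the class 1 modulo 4 excludes 7 and 11,
        and the case split excludes 5.\<close>
      by (rule p_integral_div_of_int[OF p(1) p_integral_of_int[OF p(1)] nd(4)]; use c False in \<open>auto simp: cong_def\<close>)
    show ?thesis
      using unit_fraction[OF r(1)] unit r(2) by (simp add: sums mult_ac)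
  qed
  show "p_cong p 3 (\<Sum>n=0..p-1. of_nat n * of_int (G6_seq n) / 432 ^ n) (2567 / 385 * of_nat p ^ 2)"
    if c: "[p = 3] (mod 4) \<and> p \<noteq> 7 \<and> p \<noteq> 11"
  proof -
    have "\<exists>r. (6 * r + 1 = p \<or> 6 * r + 1 = 5 * p) \<and> odd r"
      using c cong_6_imp(2)[OF not3] by blast
    then obtain r where r: "6 * r + 1 = p \<or> 6 * r + 1 = (6 - 1) * p" "odd r"
      by auto
    have unit: "of_int 1296 / of_int 385 \<in> p_integral p"
      by (rule p_integral_div_of_int[OF p(1) p_integral_of_int[OF p(1)] nd(4)]; use c in \<open>auto simp: cong_def\<close>)
    show ?thesis
      using unit_fraction[OF r(1)] unit r(2) by (simp add: sums mult_ac)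
  qed
qed

end
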